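(* Let $P(z)$ be a polynomial of degree $n$ with complex coefficients which does not vanish in the open disk $|z| < 1$. Then for every complex number $\alpha$ with $|\alpha| \ge 1$ and every real $p \ge 1$, $$\left\{ \int_0^{2\pi} \left| D_\alpha P(e^{i\theta}) \right|^p \, d\theta \right\}^{1/p} \le n(|\alpha| + 1)\, C_p \left\{ \int_0^{2\pi} \left| P(e^{i\theta}) \right|^p \, d\theta \right\}^{1/p},$$ where $$C_p = \left\{ \frac{1}{2\pi}\int_0^{2\pi} \left| 1 + e^{i\beta} \right|^p \, d\beta \right\}^{-1/p}.$$
   Context: For a polynomial $P(z)$ of degree $n$ and a complex number $\alpha$, the polar derivative of $P$ with respect to $\alpha$ is the polynomial $D_\alpha P(z) = nP(z) + (\alpha - z)P'(z)$, where $P'$ is the ordinary derivative. *)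

theory Defs
  imports "HOL-Analysis.Analysis" "HOL-Computational_Algebra.Polynomial"
begin

definition polar_deriv :: "complex \<Rightarrow> complex poly \<Rightarrow> complex poly" where
  "polar_deriv \<alpha> P = smult (of_nat (degree P)) P + [:\<alpha>, -1:] * pderiv P"

lemma poly_polar_deriv:
  "poly (polar_deriv \<alpha> P) z = of_nat (degree P) * poly P z + (\<alpha> - z) * poly (pderiv P) z"
  by (simp add: polar_deriv_def algebra_simps)

definition C_const :: "real \<Rightarrow> real" where
  "C_const p = (1 / (2 * pi) * integral {0..2 * pi} (\<lambda>\<beta>. norm (1 + cis \<beta>) powr p)) powr (- 1 / p)"

end

theory Submission
  imports Defs "HOL-Computational_Algebra.Fundamental_Theorem_Algebra"
begin

text \<open>
  On the unit circle \<open>z = cis \<theta>\<close> write \<open>A = n P z - z P' z\<close> and \<open>B = z P' z\<close>, so that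
  \<open>D\<^sub>\<alpha> P z = A + (\<alpha> / z) B\<close>. The modulus of \<open>A\<close> is that of the derivative of the reciprocal
  polynomial \<open>z\<^sup>n cnj (P (1 / cnj z))\<close>. Three facts combine to give the inequality.

  \<^item> If \<open>P\<close> has no zero in the open disk, then \<open>|B| \<le> |A|\<close>: every root contributes at most
    \<open>1/2\<close> to the real part of \<open>z P'/P\<close>, so \<open>B/P\<close> does not lie beyond the line
    \<open>Re = n/2\<close> (\<open>norm_deriv_le_norm_reciprocal_deriv\<close>).

  \<^item> If \<open>|B| \<le> |A|\<close> and \<open>|\<alpha>| \<ge> 1\<close>, then \<open>|A + \<alpha> B|\<^sup>p\<close> times the integral of \<open>|1 + cis \<beta>|\<^sup>p\<close>
    is at most \<open>(|\<alpha>| + 1)\<^sup>p\<close> times the integral of \<open>|A + cis \<beta> B|\<^sup>p\<close>. After a rotation in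
    \<open>\<beta>\<close> this is an elementary inequality between integrands
    (\<open>norm_add_mult_powr_integral_le\<close>). The constant \<open>C\<^sub>p\<close> comes from here.

  \<^item> For each fixed unimodular \<open>\<eta>\<close>, the operator taking \<open>P\<close> to \<open>n P - z P' + \<eta> z P'\<close> has norm
    at most \<open>n\<close> on the polynomials of degree at most \<open>n\<close> with the \<open>L\<^sup>p\<close> norm of the circle,
    \<open>p \<ge> 1\<close>. Indeed it is \<open>n\<close> times an average of the rotates \<open>P (\<zeta>\<^sub>j z)\<close> over the \<open>n\<close>-th
    roots \<open>\<zeta>\<^sub>j\<close> of \<open>\<eta>\<close>, with nonnegative Fejer weights (\<open>riesz_interpolation\<close>), and Jensen's
    inequality applies (\<open>integral_multiplier_le\<close>).

  Integrating the second fact over \<open>\<theta>\<close>, exchanging the order of integration, and applying the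
  third fact with \<open>\<eta> = cis \<beta>\<close> for each \<open>\<beta>\<close> yields the inequality between \<open>p\<close>-th powers
  (\<open>integral_polar_deriv_le\<close>).
\<close>

section \<open>Jensen's inequality for powers\<close>

text \<open>
  Jensen's inequality below is applied to values of \<open>|P|\<close>, which may vanish on the circle, so
  convexity on the open half-line \<open>x > 0\<close> has to be extended to the endpoint.
\<close>

lemma convex_on_powr_nonneg:
  fixes p :: real
  assumes p: "p \<ge> 1"
  shows "convex_on {0..} (\<lambda>x. x powr p)"
proof (rule convex_onI)
  have zero_case: "(s * y) powr p \<le> s * y powr p" if "0 < s" "s < 1" "0 \<le> y" for s y :: real
  proof -
    have "s powr p \<le> s powr 1"
      using that p by (intro powr_mono') auto
    hence "s powr p * y powr p \<le> s * y powr p"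
      using that by (intro mult_right_mono) auto
    thus ?thesis using that by (simp add: powr_mult)
  qed
  fix t x y :: real
  assume t: "0 < t" "t < 1" and x: "x \<in> {0..}" and y: "y \<in> {0..}"
  consider "x = 0" | "y = 0" | "x > 0" "y > 0" using x y by fastforce
  thus "((1 - t) *\<^sub>R x + t *\<^sub>R y) powr p \<le> (1 - t) * x powr p + t * y powr p"
  proof cases
    case 1
    thus ?thesis using zero_case[of t y] t y by simp
  next
    case 2
    thus ?thesis using zero_case[of "1 - t" x] t x by simp
  next
    case 3
    thus ?thesis
      using convex_onD[OF powr_convex[OF p], of t x y] t by simp
  qed
qed (rule convex_real_interval)

lemma norm_powr_convex_combination_le:
  fixes c :: "'i \<Rightarrow> complex"
  assumes "p \<ge> 1" "finite S" "(\<Sum>i\<in>S. w i) = (1::real)" "\<And>i. i \<in> S \<Longrightarrow> w i \<ge> 0"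
  shows "norm (\<Sum>i\<in>S. of_real (w i) * c i) powr p \<le> (\<Sum>i\<in>S. w i * norm (c i) powr p)"
proof -
  have "S \<noteq> {}" using assms(3) by auto
  have "norm (\<Sum>i\<in>S. of_real (w i) * c i) \<le> (\<Sum>i\<in>S. w i * norm (c i))"
    using assms(4) by (intro order_trans[OF norm_sum] sum_mono) (simp add: norm_mult)
  hence "norm (\<Sum>i\<in>S. of_real (w i) * c i) powr p \<le> (\<Sum>i\<in>S. w i *\<^sub>R norm (c i)) powr p"
    using assms(1) by (intro powr_mono2) auto
  also have "\<dots> \<le> (\<Sum>i\<in>S. w i * norm (c i) powr p)"
    by (rule convex_on_sum[OF assms(2) \<open>S \<noteq> {}\<close> convex_on_powr_nonneg[OF assms(1)] assms(3,4)]) auto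
  finally show ?thesis .
qed

section \<open>Rotation invariance of integrals over the circle\<close>

lemma continuous_on_norm_powr:
  fixes f :: "'a::topological_space \<Rightarrow> complex"
  assumes "continuous_on S f" "p > 0"
  shows "continuous_on S (\<lambda>x. norm (f x) powr p)"
  using assms by (intro continuous_on_powr' continuous_intros) auto

text \<open>
  Writing \<open>u = cis t\<close> with \<open>0 \<le> t < 2\<pi>\<close>, the rotation shifts the interval of integration to
  \<open>[t, 2\<pi> + t]\<close>; by periodicity the overhang past \<open>2\<pi>\<close> is worth the missing part \<open>[0, t]\<close>.
\<close>

lemma integral_circle_rotate:
  fixes f :: "complex \<Rightarrow> real"
  assumes f: "continuous_on (sphere 0 1) f" and u: "norm u = 1"
  shows "integral {0..2 * pi} (\<lambda>\<theta>. f (u * cis \<theta>)) = integral {0..2 * pi} (\<lambda>\<theta>. f (cis \<theta>))"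
proof -
  define t where "t = Arg2pi u"
  have ut: "u = cis t" and t: "0 \<le> t" "t < 2 * pi"
    using Arg2pi[of u] u by (auto simp: t_def cis_conv_exp is_Arg_def)
  define g where "g = (\<lambda>\<theta>. f (cis \<theta>))"
  have "continuous_on UNIV g"
    unfolding g_def by (rule continuous_on_compose2[OF f]) (auto intro!: continuous_intros)
  hence int: "g integrable_on {a..b}" for a b
    by (intro integrable_continuous_real) (rule continuous_on_subset, auto)
  have per: "g (x + 2 * pi) = g x" for x
    by (simp add: g_def flip: cis_mult)
  have "integral {0..2 * pi} (\<lambda>\<theta>. f (u * cis \<theta>)) = integral {0..2 * pi} (\<lambda>\<theta>. g (\<theta> + t))"
    by (simp add: g_def ut cis_mult add.commute)
  also have "\<dots> = integral {t..2 * pi + t} g"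
    using integral_shift_Icc_real[of 0 "2 * pi" g t] by (simp add: o_def add.commute)
  also have "\<dots> = integral {t..2 * pi} g + integral {2 * pi..2 * pi + t} g"
    by (rule Henstock_Kurzweil_Integration.integral_combine[symmetric]) (use t int in auto)
  also have "integral {2 * pi..2 * pi + t} g = integral {0..t} g"
    using integral_shift_Icc_real[of 0 t g "2 * pi"] by (simp add: o_def add.commute per)
  also have "integral {t..2 * pi} g + integral {0..t} g = integral {0..2 * pi} g"
    by (subst add.commute, rule Henstock_Kurzweil_Integration.integral_combine) (use t int in auto)
  finally show ?thesis by (simp add: g_def)
qed

section \<open>Interpolation at the roots of a unimodular number\<close>

text \<open>
  The points \<open>\<zeta> j\<close> are the \<open>n\<close>-th roots of \<open>cis t\<close>. The ratio of consecutive ones is the primitive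
  root of unity \<open>cis (2\<pi>/n)\<close>, so the sum is a full geometric sum, with ratio different from
  \<open>1\<close> exactly when \<open>c\<close> and \<open>b\<close> are not congruent modulo \<open>n\<close>.
\<close>

lemma sum_nth_roots_orthogonal:
  assumes \<zeta>: "\<And>j. \<zeta> j = cis ((t + 2 * pi * real j) / real n)"
    and "c < n" "b < n"
  shows "(\<Sum>j<n. \<zeta> j ^ c * cnj (\<zeta> j ^ b)) = (if c = b then of_nat n else 0)"
proof -
  define d where "d = real c - real b"
  define r where "r = cis (2 * pi * d / real n)"
  have n: "n > 0" using assms by simp
  have "\<zeta> j ^ c * cnj (\<zeta> j ^ b) = cis (t * d / n) * r ^ j" for j
  proof -
    have "\<zeta> j ^ c * cnj (\<zeta> j ^ b) = cis (d * ((t + 2 * pi * real j) / real n))"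
      unfolding \<zeta> Complex.DeMoivre cis_cnj cis_mult d_def left_diff_distrib by simp
    also have "d * ((t + 2 * pi * real j) / real n) = t * d / n + real j * (2 * pi * d / n)"
      using n by (simp add: field_simps)
    finally show ?thesis by (simp only: r_def Complex.DeMoivre cis_mult)
  qed
  hence eq: "(\<Sum>j<n. \<zeta> j ^ c * cnj (\<zeta> j ^ b)) = cis (t * d / n) * (\<Sum>j<n. r ^ j)"
    by (simp add: sum_distrib_left)
  show ?thesis
  proof (cases "c = b")
    case True
    thus ?thesis unfolding eq by (simp add: r_def d_def)
  next
    case False
    have "r ^ n = 1"
      using n cis_multiple_2pi[of d] by (simp add: r_def Complex.DeMoivre d_def)
    moreover have "r \<noteq> 1"
    proof
      assume "r = 1"
      hence "cos (2 * pi * d / n) = 1" by (simp add: r_def complex_eq_iff)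
      then obtain m :: int where "2 * pi * d / n = of_int m * 2 * pi"
        using cos_one_2pi_int by blast
      hence "d = of_int m * n" using n by (simp add: field_simps)
      hence "real_of_int (int c - int b) = real_of_int (m * int n)" by (simp add: d_def)
      hence "int c - int b = m * int n" by (simp only: of_int_eq_iff)
      hence "int n dvd int c - int b" by simp
      hence "int n \<le> \<bar>int c - int b\<bar>"
        using False dvd_imp_le_int[of "int c - int b" "int n"] by simp
      thus False using assms by linarith
    qed
    ultimately have "(\<Sum>j<n. r ^ j) = 0" by (simp add: geometric_sum)
    thus ?thesis unfolding eq using False by simp
  qed
qed

text \<open>
  Expanding the square gives terms \<open>\<zeta>\<^sup>a\<^sup>+\<^sup>k cnj (\<zeta>\<^sup>b)\<close> with \<open>a, b < n\<close>. For each \<open>a\<close>,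
  orthogonality leaves exactly one \<open>b\<close>, the residue of \<open>a + k\<close> modulo \<open>n\<close>. There is no wraparound
  for \<open>n - k\<close> values of \<open>a\<close>; for the other \<open>k\<close> values reducing the exponent by \<open>n\<close> costs a
  factor \<open>\<zeta>\<^sup>n = cis t\<close>. This is what makes the moments linear in \<open>k\<close> up to and including \<open>k = n\<close>.
\<close>

lemma fejer_weight_moments:
  assumes \<zeta>: "\<And>j. \<zeta> j = cis ((t + 2 * pi * real j) / real n)"
    and n: "n > 0" and k: "k \<le> n"
  shows "(\<Sum>j<n. of_real ((norm (\<Sum>i<n. \<zeta> j ^ i))\<^sup>2) * \<zeta> j ^ k)
       = of_nat n * (of_nat n - of_nat k + of_nat k * cis t)"
proof -
  have \<zeta>n: "\<zeta> j ^ n = cis t" for j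
  proof -
    have "\<zeta> j ^ n = cis (t + 2 * pi * real j)"
      using n by (simp add: \<zeta> Complex.DeMoivre)
    also have "\<dots> = cis t"
      using cis_multiple_2pi[of "real j"] by (simp flip: cis_mult)
    finally show ?thesis .
  qed
  have inner: "(\<Sum>b<n. \<Sum>j<n. \<zeta> j ^ (a + k) * cnj (\<zeta> j ^ b))
      = of_nat n * (if a < n - k then 1 else cis t)" if a: "a < n" for a
  proof (cases "a < n - k")
    case True
    hence "a + k < n" by simp
    thus ?thesis using True sum_nth_roots_orthogonal[of \<zeta> t n "a + k"] \<zeta> by simp
  next
    case False
    define c where "c = a + k - n"
    have c: "c < n" "a + k = n + c" using False a k by (auto simp: c_def)
    have "(\<Sum>b<n. \<Sum>j<n. \<zeta> j ^ (a + k) * cnj (\<zeta> j ^ b))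
        = cis t * (\<Sum>b<n. \<Sum>j<n. \<zeta> j ^ c * cnj (\<zeta> j ^ b))"
      by (simp add: c(2) power_add \<zeta>n sum_distrib_left mult.assoc)
    also have "\<dots> = cis t * of_nat n"
      using c(1) sum_nth_roots_orthogonal[of \<zeta> t n c] \<zeta> by simp
    finally show ?thesis using False by simp
  qed
  have "(\<Sum>j<n. of_real ((norm (\<Sum>i<n. \<zeta> j ^ i))\<^sup>2) * \<zeta> j ^ k)
      = (\<Sum>j<n. \<Sum>a<n. \<Sum>b<n. \<zeta> j ^ (a + k) * cnj (\<zeta> j ^ b))"
    unfolding complex_norm_square cnj_sum sum_product
    by (simp add: sum_distrib_left sum_distrib_right power_add mult_ac)
  also have "\<dots> = (\<Sum>a<n. \<Sum>b<n. \<Sum>j<n. \<zeta> j ^ (a + k) * cnj (\<zeta> j ^ b))"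
    by (subst sum.swap, rule sum.cong[OF refl], rule sum.swap)
  also have "\<dots> = (\<Sum>a<n. of_nat n * (if a < n - k then 1 else cis t))"
    using inner by simp
  also have "\<dots> = of_nat n * ((\<Sum>a\<in>{..<n - k}. 1) + (\<Sum>a\<in>{n - k..<n}. cis t))"
  proof -
    have "{..<n} = {..<n - k} \<union> {n - k..<n}" by auto
    thus ?thesis by (simp add: sum_distrib_left[symmetric] sum.union_disjoint ivl_disj_int)
  qed
  finally show ?thesis using k by (simp add: of_nat_diff)
qed

lemma mult_poly_pderiv_eq_sum:
  fixes P :: "complex poly"
  assumes "degree P \<le> n"
  shows "z * poly (pderiv P) z = (\<Sum>k\<le>n. of_nat k * coeff P k * z ^ k)"
proof -
  have "pderiv P = pderiv (\<Sum>k\<le>n. monom (coeff P k) k)"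
    by (simp only: poly_as_sum_of_monoms'[OF assms])
  also have "\<dots> = (\<Sum>k\<le>n. pderiv (monom (coeff P k) k))"
    using higher_pderiv_sum[of 1] by simp
  finally have "z * poly (pderiv P) z = (\<Sum>k\<le>n. z * (of_nat k * coeff P k * z ^ (k - 1)))"
    by (simp add: poly_sum pderiv_monom poly_monom sum_distrib_left)
  also have "\<dots> = (\<Sum>k\<le>n. of_nat k * coeff P k * z ^ k)"
  proof (rule sum.cong[OF refl])
    fix k show "z * (of_nat k * coeff P k * z ^ (k - 1)) = of_nat k * coeff P k * z ^ k"
      by (cases k) simp_all
  qed
  finally show ?thesis .
qed

text \<open>
  On \<open>z\<^sup>k\<close> the operator on the left multiplies by \<open>n - k + k \<eta>\<close>, which is \<open>n\<close> times the \<open>k\<close>-th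
  moment of the normalized Fejer weights; the case \<open>k = 0\<close> says that the weights sum to \<open>1\<close>.
  It matters that the weights and nodes do not depend on \<open>z\<close>: the operator is a
  convolution with a probability measure, scaled by \<open>n\<close>.
\<close>

lemma riesz_interpolation:
  fixes \<eta> :: complex and n :: nat
  assumes n: "n > 0" and \<eta>: "norm \<eta> = 1"
  obtains w :: "nat \<Rightarrow> real" and \<zeta> :: "nat \<Rightarrow> complex"
  where "\<And>j. w j \<ge> 0" "(\<Sum>j<n. w j) = 1" "\<And>j. norm (\<zeta> j) = 1"
    "\<And>P z. degree P \<le> n \<Longrightarrow>
      of_nat n * poly P z - z * poly (pderiv P) z + \<eta> * (z * poly (pderiv P) z)
        = of_nat n * (\<Sum>j<n. of_real (w j) * poly P (\<zeta> j * z))"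
proof -
  define t where "t = Arg2pi \<eta>"
  have \<eta>t: "\<eta> = cis t"
    using Arg2pi[of \<eta>] \<eta> by (auto simp: t_def cis_conv_exp is_Arg_def)
  define \<zeta> where "\<zeta> = (\<lambda>j::nat. cis ((t + 2 * pi * real j) / real n))"
  define w where "w = (\<lambda>j. (norm (\<Sum>i<n. \<zeta> j ^ i))\<^sup>2 / (real n)\<^sup>2)"
  have moments: "of_nat n * (\<Sum>j<n. of_real (w j) * \<zeta> j ^ k) = of_nat n - of_nat k + of_nat k * \<eta>"
    if "k \<le> n" for k
  proof -
    have "of_nat n * (\<Sum>j<n. of_real (w j) * \<zeta> j ^ k)
       = (\<Sum>j<n. of_real ((norm (\<Sum>i<n. \<zeta> j ^ i))\<^sup>2) * \<zeta> j ^ k) / of_nat n"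
      using n by (simp add: w_def sum_distrib_left sum_divide_distrib power2_eq_square)
    also have "(\<Sum>j<n. of_real ((norm (\<Sum>i<n. \<zeta> j ^ i))\<^sup>2) * \<zeta> j ^ k)
       = of_nat n * (of_nat n - of_nat k + of_nat k * cis t)"
      by (rule fejer_weight_moments[OF _ n that]) (simp add: \<zeta>_def)
    finally show ?thesis using n by (simp add: \<eta>t)
  qed
  show thesis
  proof (rule that[of w \<zeta>])
    have "complex_of_real (\<Sum>j<n. w j) = 1" using moments[of 0] n by simp
    thus "(\<Sum>j<n. w j) = 1" using of_real_eq_1_iff by blast
    show "w j \<ge> 0" "norm (\<zeta> j) = 1" for j by (simp_all add: w_def \<zeta>_def)
    fix P :: "complex poly" and z
    assume P: "degree P \<le> n"
    have poly_eq: "poly P x = (\<Sum>k\<le>n. coeff P k * x ^ k)" for x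
      using poly_as_sum_of_monoms'[OF P] by (metis (no_types, lifting) poly_monom poly_sum sum.cong)
    have "of_nat n * poly P z - z * poly (pderiv P) z + \<eta> * (z * poly (pderiv P) z)
       = (\<Sum>k\<le>n. (of_nat n - of_nat k + of_nat k * \<eta>) * (coeff P k * z ^ k))"
      by (simp add: mult_poly_pderiv_eq_sum[OF P] poly_eq sum_distrib_left algebra_simps
            sum.distrib sum_subtractf)
    also have "\<dots> = (\<Sum>k\<le>n. of_nat n * (\<Sum>j<n. of_real (w j) * \<zeta> j ^ k) * (coeff P k * z ^ k))"
      using moments by simp
    also have "\<dots> = (\<Sum>k\<le>n. \<Sum>j<n. of_nat n * (of_real (w j) * (coeff P k * (\<zeta> j * z) ^ k)))"
      by (simp add: sum_distrib_left sum_distrib_right power_mult_distrib mult_ac)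
    also have "\<dots> = of_nat n * (\<Sum>j<n. of_real (w j) * poly P (\<zeta> j * z))"
      by (subst sum.swap) (simp add: poly_eq sum_distrib_left)
    finally show "of_nat n * poly P z - z * poly (pderiv P) z + \<eta> * (z * poly (pderiv P) z)
        = of_nat n * (\<Sum>j<n. of_real (w j) * poly P (\<zeta> j * z))" .
  qed
qed

text \<open>
  Jensen's inequality bounds the integrand by an average of \<open>n\<^sup>p |P (\<zeta>\<^sub>j z)|\<^sup>p\<close>, and all these
  rotates have the same integral as \<open>n\<^sup>p |P|\<^sup>p\<close>.
\<close>

lemma integral_multiplier_le:
  fixes P :: "complex poly"
  assumes P: "degree P \<le> n" and n: "n > 0" and \<eta>: "norm \<eta> = 1" and p: "p \<ge> 1"
  shows "integral {0..2 * pi} (\<lambda>\<theta>. norm (of_nat n * poly P (cis \<theta>) - cis \<theta> * poly (pderiv P) (cis \<theta>)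
            + \<eta> * (cis \<theta> * poly (pderiv P) (cis \<theta>))) powr p)
    \<le> real n powr p * integral {0..2 * pi} (\<lambda>\<theta>. norm (poly P (cis \<theta>)) powr p)"
    (is "integral _ (\<lambda>\<theta>. norm (?M \<theta>) powr p) \<le> _ * integral _ ?f")
proof -
  obtain w :: "nat \<Rightarrow> real" and \<zeta> :: "nat \<Rightarrow> complex"
    where w: "\<And>j. w j \<ge> 0" "(\<Sum>j<n. w j) = 1" and \<zeta>: "\<And>j. norm (\<zeta> j) = 1"
      and interpolation: "\<And>P z. degree P \<le> n \<Longrightarrow>
        of_nat n * poly P z - z * poly (pderiv P) z + \<eta> * (z * poly (pderiv P) z)
          = of_nat n * (\<Sum>j<n. of_real (w j) * poly P (\<zeta> j * z))"
    using riesz_interpolation[OF n \<eta>] by blast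
  have M: "?M \<theta> = of_nat n * (\<Sum>j<n. of_real (w j) * poly P (\<zeta> j * cis \<theta>))" for \<theta>
    by (rule interpolation[OF P])
  have int: "(\<lambda>\<theta>. norm (poly P (\<zeta> j * cis \<theta>)) powr p) integrable_on {0..2 * pi}" for j
    using p by (intro integrable_continuous_real continuous_on_norm_powr continuous_intros) auto
  have "integral {0..2 * pi} (\<lambda>\<theta>. norm (?M \<theta>) powr p)
     \<le> integral {0..2 * pi} (\<lambda>\<theta>. real n powr p * (\<Sum>j<n. w j * norm (poly P (\<zeta> j * cis \<theta>)) powr p))"
  proof (rule integral_le)
    show "(\<lambda>\<theta>. norm (?M \<theta>) powr p) integrable_on {0..2 * pi}"
      using p by (intro integrable_continuous_real continuous_on_norm_powr continuous_intros) auto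
    show "(\<lambda>\<theta>. real n powr p * (\<Sum>j<n. w j * norm (poly P (\<zeta> j * cis \<theta>)) powr p))
        integrable_on {0..2 * pi}"
      by (intro integrable_on_mult_right Henstock_Kurzweil_Integration.integrable_sum int) auto
    show "norm (?M \<theta>) powr p \<le> real n powr p * (\<Sum>j<n. w j * norm (poly P (\<zeta> j * cis \<theta>)) powr p)" for \<theta>
      unfolding M norm_mult using norm_powr_convex_combination_le[OF p _ w(2) w(1)]
      by (simp add: powr_mult mult_left_mono)
  qed
  also have "\<dots> = real n powr p * (\<Sum>j<n. w j * integral {0..2 * pi} (\<lambda>\<theta>. norm (poly P (\<zeta> j * cis \<theta>)) powr p))"
    by (simp add: Henstock_Kurzweil_Integration.integral_sum int integrable_on_mult_right)
  also have "\<dots> = real n powr p * (\<Sum>j<n. w j * integral {0..2 * pi} ?f)"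
  proof -
    have "integral {0..2 * pi} (\<lambda>\<theta>. norm (poly P (\<zeta> j * cis \<theta>)) powr p) = integral {0..2 * pi} ?f" for j
      using p \<zeta> by (intro integral_circle_rotate[where f = "\<lambda>z. norm (poly P z) powr p"]
          continuous_on_norm_powr continuous_intros) auto
    thus ?thesis by simp
  qed
  also have "\<dots> = real n powr p * integral {0..2 * pi} ?f"
    using w(2) by (simp flip: sum_distrib_right)
  finally show ?thesis .
qed

section \<open>Comparing the two parts of the polar derivative\<close>

text \<open>
  Twice the quotient minus \<open>1\<close> is \<open>(z + a) / (z - a)\<close>, whose real part has the sign of
  \<open>|z|\<^sup>2 - |a|\<^sup>2\<close>.
\<close>

lemma Re_divide_self_diff_le_half:
  assumes "norm z \<le> norm a" "z \<noteq> a"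
  shows "Re (z / (z - a)) \<le> 1 / 2"
proof -
  define w where "w = z / (z - a)"
  have "z - a \<noteq> 0" using assms by simp
  hence "2 * w - 1 = (z + a) / (z - a)"
    by (simp add: w_def field_simps)
  also have "\<dots> = (z + a) * cnj (z - a) / of_real ((norm (z - a))\<^sup>2)"
    by (rule complex_div_cnj)
  finally have "Re (2 * w - 1) = Re ((z + a) * cnj (z - a)) / (norm (z - a))\<^sup>2"
    by simp
  also have "Re ((z + a) * cnj (z - a)) = (norm z)\<^sup>2 - (norm a)\<^sup>2"
    unfolding cmod_power2 by (simp add: algebra_simps power2_eq_square)
  also have "\<dots> / (norm (z - a))\<^sup>2 \<le> 0"
    using assms(1) by (intro divide_nonpos_nonneg) (auto intro: power_mono)
  finally have "2 * Re w \<le> 1" by simp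
  thus ?thesis by (simp add: w_def)
qed

text \<open>
  The logarithmic derivative turns the product over the roots into a sum, one term
  \<open>z / (z - a)\<close> per root; the induction splits off one root at a time.
\<close>

lemma Re_log_deriv_le_half_degree:
  fixes P :: "complex poly"
  assumes "\<And>a. poly P a = 0 \<Longrightarrow> norm a \<ge> norm z" "poly P z \<noteq> 0"
  shows "Re (z * poly (pderiv P) z / poly P z) \<le> degree P / 2"
  using assms
proof (induction "degree P" arbitrary: P)
  case 0
  then obtain c where "P = [:c:]" by (metis degree_eq_zeroE)
  thus ?case by (simp add: pderiv_pCons)
next
  case (Suc n)
  have "\<not> constant (poly P)" using Suc(2) by (simp add: constant_degree)
  then obtain a where a: "poly P a = 0" using fundamental_theorem_of_algebra by blast
  then obtain R where R: "P = [:-a, 1:] * R" by (auto simp: poly_eq_0_iff_dvd elim: dvdE)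
  have "R \<noteq> 0" using R Suc(2) by auto
  hence deg: "degree P = Suc (degree R)" unfolding R by (subst degree_mult_eq) auto
  have za: "z \<noteq> a" and Rz: "poly R z \<noteq> 0" using Suc.prems(2) a R by auto
  have "z * poly (pderiv P) z / poly P z = z / (z - a) + z * poly (pderiv R) z / poly R z"
  proof -
    have "pderiv P = R + [:-a, 1:] * pderiv R"
      unfolding R pderiv_mult by (simp add: pderiv_pCons)
    hence dP: "poly (pderiv P) z = poly R z + (z - a) * poly (pderiv R) z"
      by (simp only: poly_add poly_mult) simp
    have P: "poly P z = (z - a) * poly R z"
      by (simp add: R algebra_simps)
    show ?thesis unfolding dP P using za Rz by (simp add: field_simps)
  qed
  moreover have "Re (z / (z - a)) \<le> 1 / 2"
    using Suc.prems(1)[OF a] za by (rule Re_divide_self_diff_le_half)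
  moreover have "Re (z * poly (pderiv R) z / poly R z) \<le> degree R / 2"
    using Suc.hyps deg Suc.prems(1) Rz by (intro Suc.hyps(1)) (auto simp: R)
  ultimately show ?case using deg by (simp add: field_simps)
qed

text \<open>
  Dividing by \<open>P z\<close>, the claim is that \<open>s = z P'/P\<close> is at least as close to \<open>0\<close> as to the
  degree, that is, \<open>2 Re s\<close> is at most the degree. At a zero of \<open>P\<close> both sides agree.
\<close>

lemma norm_deriv_le_norm_reciprocal_deriv:
  fixes P :: "complex poly"
  assumes roots: "\<And>a. poly P a = 0 \<Longrightarrow> norm a \<ge> norm z"
  shows "norm (z * poly (pderiv P) z) \<le> norm (of_nat (degree P) * poly P z - z * poly (pderiv P) z)"
proof (cases "poly P z = 0")
  case False
  define s where "s = z * poly (pderiv P) z / poly P z"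
  have "2 * Re s \<le> degree P"
    using Re_log_deriv_le_half_degree[OF roots False] by (simp add: s_def)
  hence "real (degree P) * (2 * Re s) \<le> real (degree P) * real (degree P)"
    by (intro mult_left_mono) auto
  hence "(norm s)\<^sup>2 \<le> (norm (of_nat (degree P) - s))\<^sup>2"
    unfolding cmod_power2 by (simp add: power2_eq_square algebra_simps)
  hence "norm s \<le> norm (of_nat (degree P) - s)" by (rule power2_le_imp_le) simp
  hence "norm s * norm (poly P z) \<le> norm (of_nat (degree P) - s) * norm (poly P z)"
    by (intro mult_right_mono) auto
  thus ?thesis using False by (simp add: s_def left_diff_distrib flip: norm_mult)
qed (simp add: norm_minus_cancel)

section \<open>The inequality between integrands and its integrated form\<close>

text \<open>
  Since \<open>b \<le> a\<close>, the ratio \<open>(a + R b) / (1 + R)\<close> decreases in \<open>R\<close>, so \<open>R = 1\<close> is the worst case.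
  For \<open>R = 1\<close> the difference of the squares of the two sides is
  \<open>2 (1 - Re u) (a - b)\<^sup>2 \<ge> 0\<close>. Equality at \<open>a = b\<close> is the reason why the integral of
  \<open>|1 + cis \<beta>|\<^sup>p\<close> gives the constant.
\<close>

lemma norm_one_plus_unit_compare:
  fixes a b R :: real and u :: complex
  assumes "0 \<le> b" "b \<le> a" "1 \<le> R" "norm u = 1"
  shows "(a + R * b) * norm (1 + u) \<le> (1 + R) * norm (of_real a + u * of_real b)"
proof -
  have u: "(Re u)\<^sup>2 + (Im u)\<^sup>2 = 1" using assms(4) by (simp add: cmod_def)
  hence "Re u \<le> 1" by (metis abs_Re_le_cmod abs_le_D1 assms(4))
  \<comment> \<open>The extra summand vanishes on the unit circle; it turns the equation into an identity
    of polynomials in \<open>a\<close>, \<open>b\<close> and the coordinates of \<open>u\<close>.\<close>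
  have "(of_real 2 * norm (of_real a + u * of_real b))\<^sup>2 - ((a + b) * norm (1 + u))\<^sup>2
      = 2 * (1 - Re u) * (a - b)\<^sup>2 + (((Re u)\<^sup>2 + (Im u)\<^sup>2) - 1) * (4 * b\<^sup>2 - (a + b)\<^sup>2)"
    unfolding power_mult_distrib cmod_power2 by (simp add: power2_eq_square algebra_simps)
  also have "\<dots> \<ge> 0" using u \<open>Re u \<le> 1\<close> by simp
  finally have "((a + b) * norm (1 + u))\<^sup>2 \<le> (2 * norm (of_real a + u * of_real b))\<^sup>2" by simp
  hence le: "(a + b) * norm (1 + u) \<le> 2 * norm (of_real a + u * of_real b)"
    by (rule power2_le_imp_le) simp
  have "(R - 1) * (a - b) \<ge> 0" using assms by simp
  hence "2 * (a + R * b) \<le> (1 + R) * (a + b)" by (simp add: algebra_simps)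
  hence "2 * (a + R * b) * norm (1 + u) \<le> (1 + R) * (a + b) * norm (1 + u)"
    by (intro mult_right_mono) auto
  also have "\<dots> \<le> (1 + R) * (2 * norm (of_real a + u * of_real b))"
    using le assms(3) by (simp add: mult.assoc mult_left_mono)
  finally have "2 * ((a + R * b) * norm (1 + u))
      \<le> 2 * ((1 + R) * norm (of_real a + u * of_real b))"
    by (simp only: mult_ac)
  thus ?thesis by (rule mult_left_le_imp_le) simp
qed

text \<open>
  The arguments of \<open>A\<close> and \<open>B\<close> only rotate \<open>cis \<beta>\<close>, which the integral over a full period
  does not see.
\<close>

lemma integral_norm_add_unit_mult:
  fixes A B :: complex
  assumes p: "p > 0"
  shows "integral {0..2 * pi} (\<lambda>\<beta>. norm (A + cis \<beta> * B) powr p)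
       = integral {0..2 * pi} (\<lambda>\<beta>. norm (of_real (norm A) + cis \<beta> * of_real (norm B)) powr p)"
proof -
  define a b where "a = cis (Arg A)" and "b = cis (Arg B)"
  have A: "A = of_real (norm A) * a" and B: "B = of_real (norm B) * b"
    using rcis_cmod_Arg[of A] rcis_cmod_Arg[of B] by (simp_all add: a_def b_def rcis_def)
  define u where "u = b / a"
  have u: "norm u = 1" and ab: "norm a = 1" "a \<noteq> 0" "b = a * u"
    by (simp_all add: u_def a_def b_def norm_divide)
  have "norm (A + cis \<beta> * B) = norm (of_real (norm A) + u * cis \<beta> * of_real (norm B))" for \<beta>
  proof -
    have "A + cis \<beta> * B = a * (of_real (norm A) + u * cis \<beta> * of_real (norm B))"
      by (subst A, subst B) (simp add: ab(3) algebra_simps)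
    thus ?thesis by (simp add: norm_mult ab(1))
  qed
  hence "integral {0..2 * pi} (\<lambda>\<beta>. norm (A + cis \<beta> * B) powr p)
      = integral {0..2 * pi} (\<lambda>\<beta>. norm (of_real (norm A) + (u * cis \<beta>) * of_real (norm B)) powr p)"
    by simp
  also have "\<dots> = integral {0..2 * pi} (\<lambda>\<beta>. norm (of_real (norm A) + cis \<beta> * of_real (norm B)) powr p)"
    using p u by (intro integral_circle_rotate[where f = "\<lambda>z. norm (of_real (norm A) + z * of_real (norm B)) powr p"]
          continuous_on_norm_powr continuous_intros) auto
  finally show ?thesis .
qed

text \<open>
  This trades the multiplier \<open>\<alpha>\<close>, arbitrary of modulus at least \<open>1\<close>, for an average over
  unimodular multipliers, where interpolation is available.
\<close>

lemma norm_add_mult_powr_integral_le: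
  fixes A B \<alpha> :: complex
  assumes "norm B \<le> norm A" "norm \<alpha> \<ge> 1" "p \<ge> 1"
  shows "norm (A + \<alpha> * B) powr p * integral {0..2 * pi} (\<lambda>\<beta>. norm (1 + cis \<beta>) powr p)
    \<le> (norm \<alpha> + 1) powr p * integral {0..2 * pi} (\<lambda>\<beta>. norm (A + cis \<beta> * B) powr p)"
proof -
  have "norm (A + \<alpha> * B) * norm (1 + cis \<beta>)
      \<le> (norm \<alpha> + 1) * norm (of_real (norm A) + cis \<beta> * of_real (norm B))" for \<beta>
  proof -
    have "norm (A + \<alpha> * B) \<le> norm A + norm \<alpha> * norm B"
      by (metis norm_mult norm_triangle_ineq)
    hence "norm (A + \<alpha> * B) * norm (1 + cis \<beta>) \<le> (norm A + norm \<alpha> * norm B) * norm (1 + cis \<beta>)"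
      by (intro mult_right_mono) auto
    also have "\<dots> \<le> (1 + norm \<alpha>) * norm (of_real (norm A) + cis \<beta> * of_real (norm B))"
      by (rule norm_one_plus_unit_compare) (use assms in auto)
    finally show ?thesis by (simp add: add.commute)
  qed
  hence *: "(norm (A + \<alpha> * B) * norm (1 + cis \<beta>)) powr p
      \<le> ((norm \<alpha> + 1) * norm (of_real (norm A) + cis \<beta> * of_real (norm B))) powr p" for \<beta>
    using assms(3) by (intro powr_mono2) auto
  have "integral {0..2 * pi} (\<lambda>\<beta>. norm (A + \<alpha> * B) powr p * norm (1 + cis \<beta>) powr p)
    \<le> integral {0..2 * pi} (\<lambda>\<beta>. (norm \<alpha> + 1) powr p *
          norm (of_real (norm A) + cis \<beta> * of_real (norm B)) powr p)"
    using assms(3) *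
    by (intro integral_le integrable_on_cmult_left integrable_continuous_real
          continuous_on_norm_powr continuous_intros) (auto simp: powr_mult)
  thus ?thesis using assms(3)
    by (subst integral_norm_add_unit_mult[of p A B]) simp_all
qed

lemma integral_norm_one_plus_cis_pos:
  assumes "p > 0"
  shows "integral {0..2 * pi} (\<lambda>\<beta>. norm (1 + cis \<beta>) powr p) > 0"
proof -
  let ?f = "\<lambda>\<beta>. norm (1 + cis \<beta>) powr p"
  have cont: "continuous_on {0..2 * pi} ?f"
    using assms by (intro continuous_on_norm_powr continuous_intros) auto
  have "integral {0..2 * pi} ?f \<noteq> 0"
  proof
    assume "integral {0..2 * pi} ?f = 0"
    hence "\<forall>x\<in>{0..2 * pi}. ?f x = 0"
      using integral_cbox_eq_0_iff[of 0 "2 * pi" ?f] cont pi_gt_zero by simp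
    hence "?f 0 = 0" by (rule bspec) simp
    thus False by simp
  qed
  moreover have "integral {0..2 * pi} ?f \<ge> 0"
    by (intro integral_nonneg integrable_continuous_real cont) auto
  ultimately show ?thesis by linarith
qed

section \<open>The inequality for the polar derivative\<close>

text \<open>
  The bound of each \<open>|D\<^sub>\<alpha> P|\<^sup>p\<close> by an average over \<open>\<beta>\<close> is integrated over \<open>\<theta>\<close>. After the
  exchange of integrals, the inner integral over \<open>\<theta>\<close> is bounded uniformly in \<open>\<beta>\<close> by
  interpolation, and the outer one contributes the factor \<open>2\<pi>\<close>.
\<close>

lemma integral_polar_deriv_le:
  fixes P :: "complex poly"
  assumes deg: "degree P = n" and n: "n > 0"
    and roots: "\<And>z. norm z < 1 \<Longrightarrow> poly P z \<noteq> 0"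
    and \<alpha>: "norm \<alpha> \<ge> 1" and p: "p \<ge> 1"
  shows "integral {0..2 * pi} (\<lambda>\<theta>. norm (poly (polar_deriv \<alpha> P) (cis \<theta>)) powr p)
        * integral {0..2 * pi} (\<lambda>\<beta>. norm (1 + cis \<beta>) powr p)
    \<le> (real n * (norm \<alpha> + 1)) powr p * (2 * pi)
        * integral {0..2 * pi} (\<lambda>\<theta>. norm (poly P (cis \<theta>)) powr p)"
proof -
  let ?I = "{0..2 * pi}"
  define K where "K = integral ?I (\<lambda>\<beta>. norm (1 + cis \<beta>) powr p)"
  define A where "A = (\<lambda>\<theta>. of_nat n * poly P (cis \<theta>) - cis \<theta> * poly (pderiv P) (cis \<theta>))"
  define B where "B = (\<lambda>\<theta>. cis \<theta> * poly (pderiv P) (cis \<theta>))"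
  define F where "F = (\<lambda>\<theta> \<beta>. norm (A \<theta> + cis \<beta> * B \<theta>) powr p)"
  have F_cont: "continuous_on S (\<lambda>(\<theta>, \<beta>). F \<theta> \<beta>)" for S
    unfolding F_def A_def B_def case_prod_unfold
    using p by (intro continuous_on_norm_powr continuous_intros) auto
  have pointwise: "norm (poly (polar_deriv \<alpha> P) (cis \<theta>)) powr p * K
      \<le> (norm \<alpha> + 1) powr p * integral ?I (F \<theta>)" for \<theta>
  proof -
    have "norm (B \<theta>) \<le> norm (A \<theta>)"
      unfolding A_def B_def deg[symmetric]
      using roots by (intro norm_deriv_le_norm_reciprocal_deriv) (force simp: not_less)
    \<comment> \<open>\<open>B\<close> carries a factor \<open>cis \<theta>\<close>, so the multiplier is \<open>\<alpha>\<close> divided by \<open>cis \<theta>\<close>, which has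
      the modulus of \<open>\<alpha>\<close>.\<close>
    moreover have "poly (polar_deriv \<alpha> P) (cis \<theta>) = A \<theta> + (\<alpha> * cis (- \<theta>)) * B \<theta>"
    proof -
      have "cis (- \<theta>) * B \<theta> = poly (pderiv P) (cis \<theta>)"
        by (simp add: B_def cis_mult flip: mult.assoc)
      thus ?thesis by (simp add: A_def poly_polar_deriv deg algebra_simps)
    qed
    ultimately show ?thesis
      using norm_add_mult_powr_integral_le[of "B \<theta>" "A \<theta>" "\<alpha> * cis (- \<theta>)" p] \<alpha> p
      by (simp add: K_def F_def norm_mult)
  qed
  have inner_int: "(\<lambda>\<theta>. integral ?I (F \<theta>)) integrable_on ?I"
    using integral_integrable_2dim[OF F_cont, of 0 "2 * pi" 0 "2 * pi"] by simp
  have inner_int': "(\<lambda>\<beta>. integral ?I (\<lambda>\<theta>. F \<theta> \<beta>)) integrable_on ?I"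
  proof -
    have "continuous_on S (\<lambda>(\<beta>, \<theta>). F \<theta> \<beta>)" for S
      unfolding F_def A_def B_def case_prod_unfold
      using p by (intro continuous_on_norm_powr continuous_intros) auto
    from integral_integrable_2dim[OF this, of 0 "2 * pi" 0 "2 * pi"] show ?thesis by simp
  qed
  have "integral ?I (\<lambda>\<theta>. norm (poly (polar_deriv \<alpha> P) (cis \<theta>)) powr p) * K
      = integral ?I (\<lambda>\<theta>. norm (poly (polar_deriv \<alpha> P) (cis \<theta>)) powr p * K)"
    by simp
  also have "\<dots> \<le> integral ?I (\<lambda>\<theta>. (norm \<alpha> + 1) powr p * integral ?I (F \<theta>))"
  proof (rule integral_le)
    show "(\<lambda>\<theta>. norm (poly (polar_deriv \<alpha> P) (cis \<theta>)) powr p * K) integrable_on ?I"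
      using p by (intro integrable_continuous_real continuous_on_mult_right
          continuous_on_norm_powr continuous_intros) auto
    show "(\<lambda>\<theta>. (norm \<alpha> + 1) powr p * integral ?I (F \<theta>)) integrable_on ?I"
      by (intro integrable_on_mult_right inner_int)
  qed (rule pointwise)
  also have "\<dots> = (norm \<alpha> + 1) powr p * integral ?I (\<lambda>\<beta>. integral ?I (\<lambda>\<theta>. F \<theta> \<beta>))"
    using integral_swap_continuous[OF F_cont, of 0 "2 * pi" 0 "2 * pi"] by simp
  also have "\<dots> \<le> (norm \<alpha> + 1) powr p *
      integral ?I (\<lambda>\<beta>. real n powr p * integral ?I (\<lambda>\<theta>. norm (poly P (cis \<theta>)) powr p))"
  proof (intro mult_left_mono integral_le inner_int')
    fix \<beta>
    show "integral ?I (\<lambda>\<theta>. F \<theta> \<beta>) \<le> real n powr p * integral ?I (\<lambda>\<theta>. norm (poly P (cis \<theta>)) powr p)"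
      unfolding F_def A_def B_def using deg n p by (intro integral_multiplier_le) auto
  qed auto
  finally show ?thesis by (simp add: K_def powr_mult mult_ac)
qed

theorem theorem2:
  fixes P :: "complex poly" and n :: nat and \<alpha> :: complex and p :: real
  assumes "degree P = n"
    and "\<And>z. norm z < 1 \<Longrightarrow> poly P z \<noteq> 0"
    and "norm \<alpha> \<ge> 1"
    and "p \<ge> 1"
  shows "(integral {0..2 * pi} (\<lambda>\<theta>. norm (poly (polar_deriv \<alpha> P) (cis \<theta>)) powr p)) powr (1 / p)
    \<le> real n * (norm \<alpha> + 1) * C_const p *
      (integral {0..2 * pi} (\<lambda>\<theta>. norm (poly P (cis \<theta>)) powr p)) powr (1 / p)"
proof (cases "n = 0")
  case True
  then obtain c where "P = [:c:]" using assms(1) by (metis degree_eq_zeroE)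
  hence "polar_deriv \<alpha> P = 0" by (simp add: polar_deriv_def pderiv_pCons)
  thus ?thesis using True by simp
next
  case False
  define D where "D = integral {0..2 * pi} (\<lambda>\<theta>. norm (poly (polar_deriv \<alpha> P) (cis \<theta>)) powr p)"
  define I where "I = integral {0..2 * pi} (\<lambda>\<theta>. norm (poly P (cis \<theta>)) powr p)"
  define K where "K = integral {0..2 * pi} (\<lambda>\<beta>. norm (1 + cis \<beta>) powr p)"
  define c where "c = real n * (norm \<alpha> + 1)"
  have nonneg: "D \<ge> 0" "I \<ge> 0" "c \<ge> 0" and K: "K > 0"
    unfolding D_def I_def c_def K_def using assms(4) integral_norm_one_plus_cis_pos[of p]
    by (auto intro!: integral_nonneg integrable_continuous_real continuous_on_norm_powr
          continuous_intros)
  have "D * K \<le> c powr p * (2 * pi) * I"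
    unfolding D_def K_def I_def c_def using False assms by (intro integral_polar_deriv_le) auto
  hence "D \<le> c powr p * (1 / (1 / (2 * pi) * K)) * I"
    using K by (simp add: field_simps)
  hence "D powr (1 / p) \<le> (c powr p * (1 / (1 / (2 * pi) * K)) * I) powr (1 / p)"
    using nonneg assms(4) by (intro powr_mono2) auto
  also have "\<dots> = (c powr p) powr (1 / p) * (1 / (1 / (2 * pi) * K)) powr (1 / p) * I powr (1 / p)"
    using K nonneg by (simp only: powr_mult)
  also have "(c powr p) powr (1 / p) = c"
    using nonneg assms(4) by (simp add: powr_powr)
  also have "(1 / (1 / (2 * pi) * K)) powr (1 / p) = C_const p"
  proof -
    have "(1 / x) powr (1 / p) = x powr (- (1 / p))" if "x > 0" for x :: real
      using that by (simp add: powr_divide powr_minus_divide)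
    from this[of "1 / (2 * pi) * K"] show ?thesis
      unfolding C_const_def K_def[symmetric] using K by simp
  qed
  finally show ?thesis unfolding D_def I_def c_def .
qed

end
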